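(* Let $D$ be a division ring, $\sigma$ an endomorphism of $D$, $\delta$ a $\sigma$-derivation on $D$, and $R = D[x,\sigma,\delta]$ the skew polynomial ring. Let $a \in D$, $f \in R$ and let $r \geq 1$ be an integer. Suppose that $f^{\circ r}(a) = a$ and that $a$ interchanges with $\big(f^{\circ 0}(a), f^{\circ 1}(a),\ldots,f^{\circ (r-1)}(a)\big)$. Then $a$ is $r$-periodic with respect to $f$ (that is, $f^{\circ nr}(a) = a$ for all $n \ge 0$), and $a$ interchanges with the whole orbit $\big(f^{\circ 1}(a),f^{\circ 2}(a),\ldots\big)$.
   Context: Let $D$ be a division ring and $\sigma$ an endomorphism of $D$ (with $\sigma(1)=1$). A $\sigma$-derivation on $D$ is an additive map $\delta: D \to D$ with $\delta(ab) = \sigma(a)\delta(b)+\delta(a)b$ for all $a,b\in D$. The skew polynomial ring $R = D[x,\sigma,\delta]$ consists of the polynomials $\sum f_i x^i$ with coefficients $f_i\in D$ written on the left, with usual addition and with multiplication determined by $xa = \sigma(a)x+\delta(a)$ for $a \in D$. Generalized powers in $D$: for $a\in D$, $a^{[0]} = 1$ and $a^{[n+1]} = \sigma(a^{[n]})a+\delta(a^{[n]})$ for $n\ge 0$. Substitution: for $f = \sum f_i x^i \in R$ and $a \in D$, $f(a) = \sum f_i a^{[i]} \in D$. Extend $\sigma$ and $\delta$ to maps $R\to R$ coefficientwise: $\sigma(\sum f_i x^i) = \sum \sigma(f_i) x^i$ and $\delta(\sum f_i x^i) = \sum \delta(f_i)x^i$ (no claim that these are a ring endomorphism or a $\sigma$-derivation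 of $R$). For $f\in R$ define $f^{[0]}=1$ and $f^{[n+1]} = \sigma(f^{[n]})f+\delta(f^{[n]})$ for $n \ge 0$ (product in $R$). The formal composition of $f=\sum f_i x^i$ and $g$ in $R$ is $f\circ g = \sum f_i g^{[i]} \in R$. The formal powers are $f^{\circ 0} = x$ and $f^{\circ(n+1)} = f\circ f^{\circ n}$ for $n \geq 0$; in particular $f^{\circ 0}(a)=a$. An element $a\in D$ is stable (with respect to $(\sigma,\delta)$) if $\sigma(\delta(a^{[n]})) = \delta(\sigma(a^{[n]}))$ for all integers $n \ge 1$ (for $n=0$ the equality is automatic). For $a,b\in D$, we say that $a$ interchanges with $b$ if either $a=b$, or both $\sigma(a) b+\delta(a) = \sigma(b) a+\delta(b)$ and $a$ is stable. We say that $a$ interchanges with a (finite or infinite) sequence in $D$ if $a$ interchanges with every element of the sequence. *)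

theory Defs
  imports "HOL-Computational_Algebra.Polynomial"
begin

definition ring_endo :: "('a::division_ring \<Rightarrow> 'a) \<Rightarrow> bool" where
  "ring_endo \<sigma> \<longleftrightarrow>
     (\<forall>a b. \<sigma> (a + b) = \<sigma> a + \<sigma> b) \<and> (\<forall>a b. \<sigma> (a * b) = \<sigma> a * \<sigma> b) \<and> \<sigma> 1 = 1"

definition sigma_derivation :: "('a::division_ring \<Rightarrow> 'a) \<Rightarrow> ('a \<Rightarrow> 'a) \<Rightarrow> bool" where
  "sigma_derivation \<sigma> \<delta> \<longleftrightarrow>
     (\<forall>a b. \<delta> (a + b) = \<delta> a + \<delta> b) \<and> (\<forall>a b. \<delta> (a * b) = \<sigma> a * \<delta> b + \<delta> a * b)"

text \<open>
  The skew polynomial ring \<open>D[x,\<sigma>,\<delta>]\<close> is carried by \<open>'a poly\<close> with its usual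
  additive structure; \<open>coeff f i\<close> is the coefficient \<open>f\<^sub>i\<close> written to the left of \<open>x\<^sup>i\<close>.
  The library multiplication on \<open>'a poly\<close> needs commuting coefficients and is never used.
  Instead, \<open>x g = \<Sum> (\<sigma>(g\<^sub>i) x + \<delta>(g\<^sub>i)) x\<^sup>i\<close> as forced by \<open>x a = \<sigma>(a) x + \<delta>(a)\<close>, and
  \<open>f g = \<Sum> f\<^sub>i (x\<^sup>i g)\<close>. The maps \<open>map_poly \<sigma>\<close> and \<open>map_poly \<delta>\<close> are the coefficientwise
  extensions of \<open>\<sigma>\<close> and \<open>\<delta>\<close>.
\<close>

definition left_scale :: "'a::division_ring \<Rightarrow> 'a poly \<Rightarrow> 'a poly" where
  "left_scale c g = map_poly (\<lambda>b. c * b) g"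

definition x_times :: "('a::division_ring \<Rightarrow> 'a) \<Rightarrow> ('a \<Rightarrow> 'a) \<Rightarrow> 'a poly \<Rightarrow> 'a poly" where
  "x_times \<sigma> \<delta> g = pCons 0 (map_poly \<sigma> g) + map_poly \<delta> g"

definition skew_mult ::
    "('a::division_ring \<Rightarrow> 'a) \<Rightarrow> ('a \<Rightarrow> 'a) \<Rightarrow> 'a poly \<Rightarrow> 'a poly \<Rightarrow> 'a poly" where
  "skew_mult \<sigma> \<delta> f g = (\<Sum>i\<le>degree f. left_scale (coeff f i) ((x_times \<sigma> \<delta> ^^ i) g))"

fun gen_pow :: "('a::division_ring \<Rightarrow> 'a) \<Rightarrow> ('a \<Rightarrow> 'a) \<Rightarrow> 'a \<Rightarrow> nat \<Rightarrow> 'a" where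
  "gen_pow \<sigma> \<delta> a 0 = 1"
| "gen_pow \<sigma> \<delta> a (Suc n) = \<sigma> (gen_pow \<sigma> \<delta> a n) * a + \<delta> (gen_pow \<sigma> \<delta> a n)"

definition skew_eval :: "('a::division_ring \<Rightarrow> 'a) \<Rightarrow> ('a \<Rightarrow> 'a) \<Rightarrow> 'a poly \<Rightarrow> 'a \<Rightarrow> 'a" where
  "skew_eval \<sigma> \<delta> f a = (\<Sum>i\<le>degree f. coeff f i * gen_pow \<sigma> \<delta> a i)"

text \<open>The polynomial \<open>[:1:]\<close> is the unit of the skew polynomial ring, and \<open>[:0, 1:]\<close> is \<open>x\<close>.\<close>

fun poly_gen_pow ::
    "('a::division_ring \<Rightarrow> 'a) \<Rightarrow> ('a \<Rightarrow> 'a) \<Rightarrow> 'a poly \<Rightarrow> nat \<Rightarrow> 'a poly" where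
  "poly_gen_pow \<sigma> \<delta> f 0 = [:1:]"
| "poly_gen_pow \<sigma> \<delta> f (Suc n) =
     skew_mult \<sigma> \<delta> (map_poly \<sigma> (poly_gen_pow \<sigma> \<delta> f n)) f + map_poly \<delta> (poly_gen_pow \<sigma> \<delta> f n)"

definition skew_comp ::
    "('a::division_ring \<Rightarrow> 'a) \<Rightarrow> ('a \<Rightarrow> 'a) \<Rightarrow> 'a poly \<Rightarrow> 'a poly \<Rightarrow> 'a poly" where
  "skew_comp \<sigma> \<delta> f g = (\<Sum>i\<le>degree f. left_scale (coeff f i) (poly_gen_pow \<sigma> \<delta> g i))"

fun comp_pow ::
    "('a::division_ring \<Rightarrow> 'a) \<Rightarrow> ('a \<Rightarrow> 'a) \<Rightarrow> 'a poly \<Rightarrow> nat \<Rightarrow> 'a poly" where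
  "comp_pow \<sigma> \<delta> f 0 = [:0, 1:]"
| "comp_pow \<sigma> \<delta> f (Suc n) = skew_comp \<sigma> \<delta> f (comp_pow \<sigma> \<delta> f n)"

definition stable :: "('a::division_ring \<Rightarrow> 'a) \<Rightarrow> ('a \<Rightarrow> 'a) \<Rightarrow> 'a \<Rightarrow> bool" where
  "stable \<sigma> \<delta> a \<longleftrightarrow> (\<forall>n\<ge>1. \<sigma> (\<delta> (gen_pow \<sigma> \<delta> a n)) = \<delta> (\<sigma> (gen_pow \<sigma> \<delta> a n)))"

definition interchanges :: "('a::division_ring \<Rightarrow> 'a) \<Rightarrow> ('a \<Rightarrow> 'a) \<Rightarrow> 'a \<Rightarrow> 'a \<Rightarrow> bool" where
  "interchanges \<sigma> \<delta> a b \<longleftrightarrow> a = b \<or> (\<sigma> a * b + \<delta> a = \<sigma> b * a + \<delta> b \<and> stable \<sigma> \<delta> a)"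

definition periodic ::
    "('a::division_ring \<Rightarrow> 'a) \<Rightarrow> ('a \<Rightarrow> 'a) \<Rightarrow> 'a poly \<Rightarrow> nat \<Rightarrow> 'a \<Rightarrow> bool" where
  "periodic \<sigma> \<delta> f r a \<longleftrightarrow> (\<forall>n. skew_eval \<sigma> \<delta> (comp_pow \<sigma> \<delta> f (n * r)) a = a)"

text \<open>
  Together with the additive group structure of \<open>'a poly\<close>, the following facts confirm that
  \<open>skew_mult\<close> makes it a unital ring, generated over the constants by \<open>x\<close> subject to
  \<open>x a = \<sigma>(a) x + \<delta>(a)\<close>.
\<close>

locale skew_data =
  fixes \<sigma> \<delta> :: "'a::division_ring \<Rightarrow> 'a"
  assumes endo: "ring_endo \<sigma>" and deriv: "sigma_derivation \<sigma> \<delta>"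
begin

lemma sigma_add: "\<sigma> (a + b) = \<sigma> a + \<sigma> b"
  and sigma_mult: "\<sigma> (a * b) = \<sigma> a * \<sigma> b"
  and sigma_one [simp]: "\<sigma> 1 = 1"
  using endo by (auto simp: ring_endo_def)

lemma delta_add: "\<delta> (a + b) = \<delta> a + \<delta> b"
  and delta_mult: "\<delta> (a * b) = \<sigma> a * \<delta> b + \<delta> a * b"
  using deriv by (auto simp: sigma_derivation_def)

lemma sigma_zero [simp]: "\<sigma> 0 = 0"
  using sigma_add[of 0 0] by simp

lemma delta_zero [simp]: "\<delta> 0 = 0"
  using delta_add[of 0 0] by simp

lemma delta_one [simp]: "\<delta> 1 = 0"
  using delta_mult[of 1 1] by simp

lemma coeff_left_scale [simp]: "coeff (left_scale c g) n = c * coeff g n"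
  by (simp add: left_scale_def coeff_map_poly)

lemma coeff_x_times:
  "coeff (x_times \<sigma> \<delta> g) n = (case n of 0 \<Rightarrow> 0 | Suc m \<Rightarrow> \<sigma> (coeff g m)) + \<delta> (coeff g n)"
  by (simp add: x_times_def coeff_map_poly coeff_pCons split: nat.split)

lemma left_scale_0 [simp]: "left_scale 0 g = 0" "left_scale c 0 = 0"
  and left_scale_1 [simp]: "left_scale 1 g = g"
  and left_scale_add: "left_scale c (g + h) = left_scale c g + left_scale c h"
  and left_scale_add_left: "left_scale (c + d) g = left_scale c g + left_scale d g"
  and left_scale_left_scale: "left_scale c (left_scale d g) = left_scale (c * d) g"
  by (simp_all add: poly_eq_iff algebra_simps mult.assoc)

lemma left_scale_sum: "left_scale c (sum h A) = (\<Sum>i\<in>A. left_scale c (h i))"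
  by (induction A rule: infinite_finite_induct) (simp_all add: left_scale_add)

lemma x_times_0 [simp]: "x_times \<sigma> \<delta> 0 = 0"
  by (simp add: x_times_def)

lemma x_times_add: "x_times \<sigma> \<delta> (g + h) = x_times \<sigma> \<delta> g + x_times \<sigma> \<delta> h"
  by (simp add: poly_eq_iff coeff_x_times sigma_add delta_add algebra_simps split: nat.split)

lemma x_times_sum: "x_times \<sigma> \<delta> (sum h A) = (\<Sum>i\<in>A. x_times \<sigma> \<delta> (h i))"
  by (induction A rule: infinite_finite_induct) (simp_all add: x_times_add)

lemma x_times_left_scale:
  "x_times \<sigma> \<delta> (left_scale c g) = left_scale (\<sigma> c) (x_times \<sigma> \<delta> g) + left_scale (\<delta> c) g"
  by (simp add: poly_eq_iff coeff_x_times sigma_mult delta_mult algebra_simps split: nat.split)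

lemma x_times_pow_add:
  "(x_times \<sigma> \<delta> ^^ n) (g + h) = (x_times \<sigma> \<delta> ^^ n) g + (x_times \<sigma> \<delta> ^^ n) h"
  by (induction n) (simp_all add: x_times_add)

lemma skew_mult_eq_sum:
  assumes "degree f \<le> N"
  shows "skew_mult \<sigma> \<delta> f g = (\<Sum>i\<le>N. left_scale (coeff f i) ((x_times \<sigma> \<delta> ^^ i) g))"
  unfolding skew_mult_def
  by (rule sum.mono_neutral_left) (use assms in \<open>auto simp: coeff_eq_0\<close>)

lemma skew_mult_const: "skew_mult \<sigma> \<delta> [:c:] g = left_scale c g"
  by (simp add: skew_mult_def)

lemma skew_mult_x: "skew_mult \<sigma> \<delta> [:0, 1:] g = x_times \<sigma> \<delta> g"
  by (simp add: skew_mult_def)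

lemma skew_mult_x_const: "skew_mult \<sigma> \<delta> [:0, 1:] [:a:] = [:\<delta> a, \<sigma> a:]"
  by (simp add: skew_mult_x poly_eq_iff coeff_x_times coeff_pCons split: nat.split)

lemma skew_mult_0_left [simp]: "skew_mult \<sigma> \<delta> 0 g = 0"
  by (simp add: skew_mult_def)

lemma skew_mult_add_left:
  "skew_mult \<sigma> \<delta> (f + g) h = skew_mult \<sigma> \<delta> f h + skew_mult \<sigma> \<delta> g h"
proof -
  define N where "N = max (degree f) (degree g)"
  have "degree f \<le> N" "degree g \<le> N" "degree (f + g) \<le> N"
    by (auto simp: N_def degree_add_le_max)
  then show ?thesis
    by (simp add: skew_mult_eq_sum left_scale_add_left sum.distrib)
qed

lemma skew_mult_add_right:
  "skew_mult \<sigma> \<delta> f (g + h) = skew_mult \<sigma> \<delta> f g + skew_mult \<sigma> \<delta> f h"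
  by (simp add: skew_mult_def x_times_pow_add left_scale_add sum.distrib)

lemma skew_mult_sum_left: "skew_mult \<sigma> \<delta> (sum h A) g = (\<Sum>i\<in>A. skew_mult \<sigma> \<delta> (h i) g)"
  by (induction A rule: infinite_finite_induct) (simp_all add: skew_mult_add_left)

lemma skew_mult_left_scale:
  "skew_mult \<sigma> \<delta> (left_scale c f) g = left_scale c (skew_mult \<sigma> \<delta> f g)"
proof -
  have "degree (left_scale c f) \<le> degree f"
    by (simp add: left_scale_def map_poly_degree_leq)
  then show ?thesis
    by (simp add: skew_mult_eq_sum[of _ "degree f"] left_scale_sum left_scale_left_scale)
qed

lemma skew_mult_x_times:
  "skew_mult \<sigma> \<delta> (x_times \<sigma> \<delta> f) g = x_times \<sigma> \<delta> (skew_mult \<sigma> \<delta> f g)"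
proof -
  let ?X = "x_times \<sigma> \<delta>"
  define N where "N = degree f"
  have "degree (?X f) \<le> Suc N"
    by (rule degree_le) (auto simp: coeff_x_times N_def coeff_eq_0 split: nat.split)
  then have "skew_mult \<sigma> \<delta> (?X f) g = (\<Sum>i\<le>Suc N. left_scale (coeff (?X f) i) ((?X ^^ i) g))"
    by (rule skew_mult_eq_sum)
  also have "\<dots> = (\<Sum>i\<le>Suc N. left_scale (case i of 0 \<Rightarrow> 0 | Suc m \<Rightarrow> \<sigma> (coeff f m)) ((?X ^^ i) g))
      + (\<Sum>i\<le>Suc N. left_scale (\<delta> (coeff f i)) ((?X ^^ i) g))"
    by (simp only: coeff_x_times left_scale_add_left sum.distrib)
  also have "(\<Sum>i\<le>Suc N. left_scale (\<delta> (coeff f i)) ((?X ^^ i) g))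
      = (\<Sum>i\<le>N. left_scale (\<delta> (coeff f i)) ((?X ^^ i) g))"
    by (simp add: N_def coeff_eq_0)
  also have "(\<Sum>i\<le>Suc N. left_scale (case i of 0 \<Rightarrow> 0 | Suc m \<Rightarrow> \<sigma> (coeff f m)) ((?X ^^ i) g))
      = (\<Sum>i\<le>N. left_scale (\<sigma> (coeff f i)) (?X ((?X ^^ i) g)))"
    by (subst sum.atMost_Suc_shift) simp
  also have "\<dots> + (\<Sum>i\<le>N. left_scale (\<delta> (coeff f i)) ((?X ^^ i) g)) = ?X (skew_mult \<sigma> \<delta> f g)"
    by (simp add: skew_mult_def x_times_sum x_times_left_scale sum.distrib N_def)
  finally show ?thesis .
qed

lemma skew_mult_x_times_pow:
  "skew_mult \<sigma> \<delta> ((x_times \<sigma> \<delta> ^^ n) f) g = (x_times \<sigma> \<delta> ^^ n) (skew_mult \<sigma> \<delta> f g)"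
  by (induction n) (simp_all add: skew_mult_x_times)

lemma skew_mult_assoc:
  "skew_mult \<sigma> \<delta> (skew_mult \<sigma> \<delta> f g) h = skew_mult \<sigma> \<delta> f (skew_mult \<sigma> \<delta> g h)"
  by (simp add: skew_mult_def[of \<sigma> \<delta> f] skew_mult_sum_left skew_mult_left_scale
      skew_mult_x_times_pow)

lemma skew_mult_1_left: "skew_mult \<sigma> \<delta> [:1:] g = g"
  by (simp add: skew_mult_const)

lemma x_times_monom: "x_times \<sigma> \<delta> (monom 1 n) = monom 1 (Suc n)"
  by (simp add: poly_eq_iff coeff_x_times split: nat.split)

lemma x_times_pow_1: "(x_times \<sigma> \<delta> ^^ n) [:1:] = monom 1 n"
  by (induction n) (simp_all add: x_times_monom flip: monom_0)

lemma skew_mult_1_right: "skew_mult \<sigma> \<delta> f [:1:] = f"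
proof -
  have "left_scale c (monom 1 i) = monom c i" for c :: 'a and i
    by (simp add: poly_eq_iff)
  then show ?thesis
    by (simp add: skew_mult_def x_times_pow_1 poly_as_sum_of_monoms)
qed

end

end

theory Submission
  imports Defs
begin

text \<open>
  For \<open>b \<in> D\<close> let \<open>T\<^sub>b c = \<sigma>(c) b + \<delta>(c)\<close>. This additive map describes substitution:
  \<open>b\<^sup>[\<^sup>n\<^sup>] = T\<^sub>b\<^sup>n 1\<close>, and \<open>x h\<close> evaluates at \<open>a\<close> to \<open>T\<^sub>a (h(a))\<close>
  (\<open>skew_eval_x_times\<close>), so \<open>(h g)(a) = \<Sum> h\<^sub>i T\<^sub>a\<^sup>i (g(a))\<close>.

  Put \<open>b = g(a)\<close> and suppose that \<open>a\<close> interchanges with \<open>b\<close>. Expanding,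
  \<open>T\<^sub>a (T\<^sub>b c) - T\<^sub>b (T\<^sub>a c) = \<sigma>\<^sup>2(c) (T\<^sub>a b - T\<^sub>b a) + (\<sigma>(\<delta> c) - \<delta>(\<sigma> c)) (a - b)\<close>.
  The first summand vanishes by the interchange condition, and for \<open>c = a\<^sup>[\<^sup>i\<^sup>]\<close> the second one
  vanishes by stability (if \<open>a = b\<close>, where stability is not demanded, because of the factor
  \<open>a - b\<close>). Hence \<open>T\<^sub>a\<^sup>i b = T\<^sub>b (a\<^sup>[\<^sup>i\<^sup>])\<close> (\<open>interchanges_twist_pow\<close>), which is what
  makes substitution compatible with generalized powers, \<open>g\<^sup>[\<^sup>n\<^sup>](a) = g(a)\<^sup>[\<^sup>n\<^sup>]\<close>, and so with
  composition, \<open>(f \<circ> g)(a) = f(g(a))\<close> (\<open>skew_eval_skew_comp\<close>).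

  Thus the values \<open>b\<^sub>n\<close> of the formal powers of \<open>f\<close> at \<open>a\<close> satisfy \<open>b\<^sub>n\<^sub>+\<^sub>1 = f(b\<^sub>n)\<close> as long as
  \<open>a\<close> interchanges with \<open>b\<^sub>n\<close>. Since \<open>b\<^sub>r = a = b\<^sub>0\<close> and \<open>a\<close> interchanges with
  \<open>b\<^sub>0, \<dots>, b\<^sub>r\<^sub>-\<^sub>1\<close>, induction gives \<open>b\<^sub>n = b\<^sub>m\<close> for \<open>m = n mod r\<close>, and every value of the orbit is
  one of those with which \<open>a\<close> interchanges by hypothesis.
\<close>

text \<open>
  The map \<open>T\<^sub>b\<close>: the pseudo-linear transformation of \<open>D\<close> by which \<open>x\<close> acts on values at \<open>b\<close>.
\<close>

definition twist :: "('a::division_ring \<Rightarrow> 'a) \<Rightarrow> ('a \<Rightarrow> 'a) \<Rightarrow> 'a \<Rightarrow> 'a \<Rightarrow> 'a" where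
  "twist \<sigma> \<delta> b c = \<sigma> c * b + \<delta> c"

context skew_data
begin

lemma sigma_sum: "\<sigma> (sum h A) = (\<Sum>i\<in>A. \<sigma> (h i))"
  by (induction A rule: infinite_finite_induct) (simp_all add: sigma_add)

lemma delta_sum: "\<delta> (sum h A) = (\<Sum>i\<in>A. \<delta> (h i))"
  by (induction A rule: infinite_finite_induct) (simp_all add: delta_add)

lemma skew_eval_eq_sum:
  assumes "degree f \<le> N"
  shows "skew_eval \<sigma> \<delta> f a = (\<Sum>i\<le>N. coeff f i * gen_pow \<sigma> \<delta> a i)"
  unfolding skew_eval_def
  by (rule sum.mono_neutral_left) (use assms in \<open>auto simp: coeff_eq_0\<close>)

lemma skew_eval_0 [simp]: "skew_eval \<sigma> \<delta> 0 a = 0"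
  by (simp add: skew_eval_def)

lemma skew_eval_x [simp]: "skew_eval \<sigma> \<delta> [:0, 1:] a = a"
  by (simp add: skew_eval_def)

lemma skew_eval_1 [simp]: "skew_eval \<sigma> \<delta> [:1:] a = 1"
  by (simp add: skew_eval_def)

lemma skew_eval_add: "skew_eval \<sigma> \<delta> (f + g) a = skew_eval \<sigma> \<delta> f a + skew_eval \<sigma> \<delta> g a"
proof -
  define N where "N = max (degree f) (degree g)"
  have "degree f \<le> N" "degree g \<le> N" "degree (f + g) \<le> N"
    by (auto simp: N_def degree_add_le_max)
  then show ?thesis
    by (simp add: skew_eval_eq_sum distrib_right sum.distrib)
qed

lemma skew_eval_sum: "skew_eval \<sigma> \<delta> (sum h A) a = (\<Sum>i\<in>A. skew_eval \<sigma> \<delta> (h i) a)"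
  by (induction A rule: infinite_finite_induct) (simp_all add: skew_eval_add)

lemma skew_eval_left_scale: "skew_eval \<sigma> \<delta> (left_scale c g) a = c * skew_eval \<sigma> \<delta> g a"
proof -
  have "degree (left_scale c g) \<le> degree g"
    by (simp add: left_scale_def map_poly_degree_leq)
  then show ?thesis
    by (simp add: skew_eval_eq_sum[of _ "degree g"] sum_distrib_left mult.assoc)
qed

lemma skew_eval_map_poly:
  assumes "\<phi> 0 = 0"
  shows "skew_eval \<sigma> \<delta> (map_poly \<phi> g) a = (\<Sum>i\<le>degree g. \<phi> (coeff g i) * gen_pow \<sigma> \<delta> a i)"
  using assms by (simp add: skew_eval_eq_sum[OF map_poly_degree_leq] coeff_map_poly)

lemma skew_eval_pCons_0:
  "skew_eval \<sigma> \<delta> (pCons 0 h) a = (\<Sum>i\<le>degree h. coeff h i * gen_pow \<sigma> \<delta> a (Suc i))"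
proof -
  have "degree (pCons 0 h) \<le> Suc (degree h)"
    by (rule degree_pCons_le)
  then have "skew_eval \<sigma> \<delta> (pCons 0 h) a
      = (\<Sum>i\<le>Suc (degree h). coeff (pCons 0 h) i * gen_pow \<sigma> \<delta> a i)"
    by (rule skew_eval_eq_sum)
  then show ?thesis
    by (simp only: sum.atMost_Suc_shift) simp
qed

lemma twist_sum_mult:
  "twist \<sigma> \<delta> b (\<Sum>i\<in>A. h i * c i)
    = (\<Sum>i\<in>A. \<sigma> (h i) * twist \<sigma> \<delta> b (c i)) + (\<Sum>i\<in>A. \<delta> (h i) * c i)"
  by (simp add: twist_def sigma_sum delta_sum sigma_mult delta_mult sum_distrib_right
      algebra_simps sum.distrib)

lemma skew_eval_x_times:
  "skew_eval \<sigma> \<delta> (x_times \<sigma> \<delta> g) a = twist \<sigma> \<delta> a (skew_eval \<sigma> \<delta> g a)"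
proof -
  have "skew_eval \<sigma> \<delta> (pCons 0 (map_poly \<sigma> g)) a
      = (\<Sum>i\<le>degree (map_poly \<sigma> g). \<sigma> (coeff g i) * gen_pow \<sigma> \<delta> a (Suc i))"
    by (simp add: skew_eval_pCons_0 coeff_map_poly)
  also have "\<dots> = (\<Sum>i\<le>degree g. \<sigma> (coeff g i) * gen_pow \<sigma> \<delta> a (Suc i))"
  proof (rule sum.mono_neutral_left)
    show "\<forall>i\<in>{..degree g} - {..degree (map_poly \<sigma> g)}.
        \<sigma> (coeff g i) * gen_pow \<sigma> \<delta> a (Suc i) = 0"
      using coeff_eq_0[of "map_poly \<sigma> g"] by (auto simp: coeff_map_poly)
  qed (auto simp: map_poly_degree_leq)
  finally show ?thesis
    unfolding x_times_def skew_eval_add skew_eval_map_poly[of \<delta>, OF delta_zero]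
      skew_eval_def[of \<sigma> \<delta> g] twist_sum_mult
    by (simp add: twist_def)
qed

lemma skew_eval_skew_mult:
  assumes "degree f \<le> N"
  shows "skew_eval \<sigma> \<delta> (skew_mult \<sigma> \<delta> f g) a
    = (\<Sum>i\<le>N. coeff f i * (twist \<sigma> \<delta> a ^^ i) (skew_eval \<sigma> \<delta> g a))"
proof -
  have "skew_eval \<sigma> \<delta> ((x_times \<sigma> \<delta> ^^ i) g) a = (twist \<sigma> \<delta> a ^^ i) (skew_eval \<sigma> \<delta> g a)" for i
    by (induction i) (simp_all add: skew_eval_x_times)
  then show ?thesis
    by (simp add: skew_mult_eq_sum[OF assms] skew_eval_sum skew_eval_left_scale)
qed

lemma twist_commute:
  assumes "twist \<sigma> \<delta> a b = twist \<sigma> \<delta> b a" and "\<sigma> (\<delta> c) = \<delta> (\<sigma> c)"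
  shows "twist \<sigma> \<delta> a (twist \<sigma> \<delta> b c) = twist \<sigma> \<delta> b (twist \<sigma> \<delta> a c)"
proof -
  have *: "twist \<sigma> \<delta> u (twist \<sigma> \<delta> v c)
      = \<sigma> (\<sigma> c) * twist \<sigma> \<delta> u v + \<delta> (\<sigma> c) * (u + v) + \<delta> (\<delta> c)" for u v
    by (simp add: twist_def sigma_add sigma_mult delta_add delta_mult assms(2) algebra_simps)
  show ?thesis
    unfolding * assms(1) by (simp add: add.commute)
qed

text \<open>
  The left-hand side is the value of \<open>x\<^sup>n b\<close> at \<open>a\<close>, that is, of \<open>x\<^sup>n g\<close> for any \<open>g\<close> with
  \<open>g(a) = b\<close>; the right-hand side is the step \<open>T\<^sub>b\<close> of the recursion for generalized powers of
  \<open>b\<close>, applied to the value of \<open>x\<^sup>n\<close> at \<open>a\<close>.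
\<close>

lemma interchanges_twist_pow:
  assumes "interchanges \<sigma> \<delta> a b"
  shows "(twist \<sigma> \<delta> a ^^ n) b = twist \<sigma> \<delta> b (gen_pow \<sigma> \<delta> a n)"
proof (induction n)
  case 0
  show ?case
    by (simp add: twist_def)
next
  case (Suc n)
  have "twist \<sigma> \<delta> a (twist \<sigma> \<delta> b (gen_pow \<sigma> \<delta> a n))
      = twist \<sigma> \<delta> b (twist \<sigma> \<delta> a (gen_pow \<sigma> \<delta> a n))"
  proof (cases "a = b")
    case False
    with assms have eq: "twist \<sigma> \<delta> a b = twist \<sigma> \<delta> b a" and "stable \<sigma> \<delta> a"
      by (simp_all add: interchanges_def twist_def)
    \<comment> \<open>stability only speaks of positive exponents; for exponent 0 both sides vanish\<close>
    then have "\<sigma> (\<delta> (gen_pow \<sigma> \<delta> a n)) = \<delta> (\<sigma> (gen_pow \<sigma> \<delta> a n))"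
      by (cases n) (auto simp: stable_def simp del: gen_pow.simps(2))
    with eq show ?thesis
      by (rule twist_commute)
  qed simp
  then show ?case
    using Suc.IH by (simp add: twist_def[of \<sigma> \<delta> a "gen_pow \<sigma> \<delta> a n"])
qed

lemma skew_eval_poly_gen_pow:
  assumes "interchanges \<sigma> \<delta> a (skew_eval \<sigma> \<delta> g a)"
  shows "skew_eval \<sigma> \<delta> (poly_gen_pow \<sigma> \<delta> g n) a = gen_pow \<sigma> \<delta> (skew_eval \<sigma> \<delta> g a) n"
proof (induction n)
  case 0
  show ?case
    by simp
next
  case (Suc n)
  let ?b = "skew_eval \<sigma> \<delta> g a" and ?h = "poly_gen_pow \<sigma> \<delta> g n"
  have "skew_eval \<sigma> \<delta> (poly_gen_pow \<sigma> \<delta> g (Suc n)) a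
      = (\<Sum>i\<le>degree ?h. \<sigma> (coeff ?h i) * (twist \<sigma> \<delta> a ^^ i) ?b)
        + (\<Sum>i\<le>degree ?h. \<delta> (coeff ?h i) * gen_pow \<sigma> \<delta> a i)"
    by (simp add: skew_eval_add skew_eval_skew_mult[OF map_poly_degree_leq] coeff_map_poly
        skew_eval_map_poly)
  also have "\<dots> = twist \<sigma> \<delta> ?b (skew_eval \<sigma> \<delta> ?h a)"
    by (simp add: interchanges_twist_pow[OF assms] skew_eval_def[of \<sigma> \<delta> ?h] twist_sum_mult)
  finally show ?case
    by (simp add: Suc.IH twist_def)
qed

lemma skew_eval_skew_comp:
  assumes "interchanges \<sigma> \<delta> a (skew_eval \<sigma> \<delta> g a)"
  shows "skew_eval \<sigma> \<delta> (skew_comp \<sigma> \<delta> f g) a = skew_eval \<sigma> \<delta> f (skew_eval \<sigma> \<delta> g a)"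
  by (simp add: skew_comp_def skew_eval_sum skew_eval_left_scale
      skew_eval_poly_gen_pow[OF assms] skew_eval_def[of \<sigma> \<delta> f])

lemma skew_eval_comp_pow_mod:
  assumes "r \<ge> 1" and return: "skew_eval \<sigma> \<delta> (comp_pow \<sigma> \<delta> f r) a = a"
    and inter: "\<And>i. i < r \<Longrightarrow> interchanges \<sigma> \<delta> a (skew_eval \<sigma> \<delta> (comp_pow \<sigma> \<delta> f i) a)"
  shows "skew_eval \<sigma> \<delta> (comp_pow \<sigma> \<delta> f n) a = skew_eval \<sigma> \<delta> (comp_pow \<sigma> \<delta> f (n mod r)) a"
proof (induction n)
  case 0
  show ?case
    by simp
next
  case (Suc n)
  let ?b = "\<lambda>n. skew_eval \<sigma> \<delta> (comp_pow \<sigma> \<delta> f n) a"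
  have step: "?b (Suc m) = skew_eval \<sigma> \<delta> f (?b m)" if "interchanges \<sigma> \<delta> a (?b m)" for m
    using that by (simp add: skew_eval_skew_comp)
  have int: "interchanges \<sigma> \<delta> a (?b (n mod r))"
    using assms(1) by (intro inter) simp
  have "?b (Suc n) = ?b (Suc (n mod r))"
    using step[of n] step[of "n mod r"] int Suc.IH by simp
  also have "\<dots> = ?b (Suc n mod r)"
    using return by (simp add: mod_Suc del: comp_pow.simps(2))
  finally show ?case .
qed

end

theorem theorem4p7:
  fixes \<sigma> \<delta> :: "'a::division_ring \<Rightarrow> 'a"
    and f :: "'a poly"
    and a :: 'a
    and r :: nat
  assumes "ring_endo \<sigma>"
    and "sigma_derivation \<sigma> \<delta>"
    and "r \<ge> 1"
    and "skew_eval \<sigma> \<delta> (comp_pow \<sigma> \<delta> f r) a = a"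
    and "\<forall>i<r. interchanges \<sigma> \<delta> a (skew_eval \<sigma> \<delta> (comp_pow \<sigma> \<delta> f i) a)"
  shows "periodic \<sigma> \<delta> f r a \<and>
         (\<forall>k\<ge>1. interchanges \<sigma> \<delta> a (skew_eval \<sigma> \<delta> (comp_pow \<sigma> \<delta> f k) a))"
proof -
  interpret skew_data \<sigma> \<delta>
    using assms(1,2) by unfold_locales
  have orbit: "skew_eval \<sigma> \<delta> (comp_pow \<sigma> \<delta> f n) a
      = skew_eval \<sigma> \<delta> (comp_pow \<sigma> \<delta> f (n mod r)) a" for n
    using assms(3-5) by (intro skew_eval_comp_pow_mod) auto
  have "periodic \<sigma> \<delta> f r a"
    unfolding periodic_def
  proof
    fix n
    show "skew_eval \<sigma> \<delta> (comp_pow \<sigma> \<delta> f (n * r)) a = a"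
      using orbit[of "n * r"] by simp
  qed
  moreover have "interchanges \<sigma> \<delta> a (skew_eval \<sigma> \<delta> (comp_pow \<sigma> \<delta> f k) a)" for k
    using assms(3,5) unfolding orbit[of k] by simp
  ultimately show ?thesis
    by blast
qed

end
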